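(* Let the deformation field be given by $$\mathbf{G}_t(\boldsymbol{x};\boldsymbol{z})=\boldsymbol{x}+t\,\boldsymbol{V}(\boldsymbol{x};\boldsymbol{z}),\qquad \boldsymbol{V}(\boldsymbol{x};\boldsymbol{z})=\sum_{i=1}^{M}z_i\boldsymbol{V}_i(\boldsymbol{x}),\qquad \boldsymbol{x}\in\mathrm{D}_0 .$$ Then the parametric derivatives at $t=0$ of the deformation coefficients $$\mathbf{C}_t=\frac{1}{\det(\partial\mathbf{G}_t)}\,\partial\mathbf{G}_t^\top\,\partial\mathbf{G}_t,\qquad \mathbf{A}_t=\det(\partial\mathbf{G}_t)\,\partial\mathbf{G}_t^{-1}\,\partial\mathbf{G}_t^{-\top}$$ are given by $$\mathrm{d}_t\mathbf{C}_t=-\sum_{i=1}^{M}z_i\big[\mathrm{d}_t\mathbf{B}_t\big]_i,\qquad \mathrm{d}_t\mathbf{A}_t=\sum_{i=1}^{M}z_i\big[\mathrm{d}_t\mathbf{B}_t\big]_i,$$ where $$\big[\mathrm{d}_t\mathbf{B}_t\big]_i=\operatorname{tr}(\partial\boldsymbol{V}_i)\,\boldsymbol{I}-\partial\boldsymbol{V}_i-\partial\boldsymbol{V}_i^\top .$$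
   Context: $\mathrm{D}_0\subset\mathbb{R}^3$ is a bounded Lipschitz domain, $M\in\mathbb{N}\cup\{\infty\}$, $\boldsymbol{z}=(z_i)_{i=1}^M\in[-1,1]^M$, where the $z_i$ are i.i.d. random variables uniformly distributed on $[-1,1]$. The vector fields $\boldsymbol{V}_i:\mathrm{D}_0\to\mathbb{R}^3$ are sufficiently smooth (continuously differentiable); for $M=\infty$ they are assumed to be such that the sum $\sum_i z_i\boldsymbol{V}_i$ converges absolutely in $C^1$. The symbol $\partial$ denotes the derivative (Jacobian) with respect to $\boldsymbol{x}\in\mathrm{D}_0$, $\boldsymbol{I}$ is the $3\times3$ identity matrix, and for a differentiable function $\mathbf{F}_t$ of $t$, $\mathrm{d}_t\mathbf{F}_t=\frac{\mathrm{d}}{\mathrm{d}t}\mathbf{F}_t\big|_{t=0}$. The symbol $[\mathrm{d}_t\mathbf{B}_t]_i$ is merely the name of the matrix field defined in the claim. *)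

theory Defs
  imports "HOL-Probability.Probability"
begin

(* Near each boundary point, and after an orthogonal change of coordinates, the domain is the part
   of a ball lying strictly above the graph of a Lipschitz function of the first two coordinates. *)
definition bounded_lipschitz_domain :: "(real^3) set \<Rightarrow> bool" where
  "bounded_lipschitz_domain D \<longleftrightarrow>
     D \<noteq> {} \<and> open D \<and> connected D \<and> bounded D \<and>
     (\<forall>p\<in>frontier D. \<exists>r>0. \<exists>(T :: real^3 \<Rightarrow> real^3) (g :: real^2 \<Rightarrow> real) L.
        orthogonal_transformation T \<and> L-lipschitz_on UNIV g \<and>
        D \<inter> ball p r = {x \<in> ball p r. g (vector [T x $ 1, T x $ 2]) < T x $ 3})"

definition index_set :: "enat \<Rightarrow> nat set" where
  "index_set M = {i. 1 \<le> i \<and> enat i \<le> M}"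

(* Vector fields on D are total functions of which only the values on D matter: D is open in all
   uses, so the Jacobian at a point of D depends only on these values. *)
definition C1_field_on :: "(real^3) set \<Rightarrow> (real^3 \<Rightarrow> real^3) \<Rightarrow> bool" where
  "C1_field_on D f \<longleftrightarrow>
     (\<forall>x\<in>D. f differentiable (at x)) \<and> continuous_on D (\<lambda>x. jacobian f (at x))"

definition C1_norm :: "(real^3) set \<Rightarrow> (real^3 \<Rightarrow> real^3) \<Rightarrow> real" where
  "C1_norm D f = (SUP x\<in>D. norm (f x)) + (SUP x\<in>D. norm (jacobian f (at x)))"

(* The boundedness requirements say that every term has finite C1 norm; without them the suprema
   in C1_norm would be meaningless. *)
definition C1_absolutely_convergent ::
    "(real^3) set \<Rightarrow> (nat \<Rightarrow> real^3 \<Rightarrow> real^3) \<Rightarrow> nat set \<Rightarrow> bool" where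
  "C1_absolutely_convergent D f I \<longleftrightarrow>
     (\<forall>i\<in>I. C1_field_on D (f i) \<and> bounded (f i ` D) \<and>
             bounded ((\<lambda>x. jacobian (f i) (at x)) ` D)) \<and>
     (\<lambda>i. C1_norm D (f i)) summable_on I"

definition iid_uniform :: "'w measure \<Rightarrow> nat set \<Rightarrow> (nat \<Rightarrow> 'w \<Rightarrow> real) \<Rightarrow> bool" where
  "iid_uniform P I Z \<longleftrightarrow>
     prob_space P \<and> prob_space.indep_vars P (\<lambda>_. borel) Z I \<and>
     (\<forall>i\<in>I. distributed P lborel (Z i) (\<lambda>s. indicator {-1..1} s / measure lborel {-1..1::real}) \<and>
             (\<forall>\<omega>\<in>space P. Z i \<omega> \<in> {-1..1}))"

(* For finite M the infinite-sum operator is the ordinary finite sum. *)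
definition velocity ::
    "enat \<Rightarrow> (nat \<Rightarrow> real^3 \<Rightarrow> real^3) \<Rightarrow> (nat \<Rightarrow> real) \<Rightarrow> real^3 \<Rightarrow> real^3" where
  "velocity M V z x = (\<Sum>\<^sub>\<infinity>i\<in>index_set M. z i *\<^sub>R V i x)"

definition deformation ::
    "enat \<Rightarrow> (nat \<Rightarrow> real^3 \<Rightarrow> real^3) \<Rightarrow> (nat \<Rightarrow> real) \<Rightarrow> real \<Rightarrow> real^3 \<Rightarrow> real^3" where
  "deformation M V z t x = x + t *\<^sub>R velocity M V z x"

definition C_coeff :: "(real^3 \<Rightarrow> real^3) \<Rightarrow> real^3 \<Rightarrow> real^3^3" where
  "C_coeff G x = (let J = jacobian G (at x) in (1 / det J) *\<^sub>R (transpose J ** J))"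

definition A_coeff :: "(real^3 \<Rightarrow> real^3) \<Rightarrow> real^3 \<Rightarrow> real^3^3" where
  "A_coeff G x =
     (let J = jacobian G (at x) in det J *\<^sub>R (matrix_inv J ** transpose (matrix_inv J)))"

definition dB :: "(real^3 \<Rightarrow> real^3) \<Rightarrow> real^3 \<Rightarrow> real^3^3" where
  "dB v x = (let J = jacobian v (at x) in trace J *\<^sub>R mat 1 - J - transpose J)"

end

theory Submission
  imports Defs
begin

text \<open>
  Fix an outcome and a point \<open>x\<close>, and let \<open>J\<close> be the Jacobian of the velocity at \<open>x\<close>. Then the
  Jacobian of the deformation is \<open>I + t J\<close>, so both coefficients are functions of a single matrix
  moving along a line through the identity. At \<open>t = 0\<close> the determinant has derivative \<open>tr J\<close>, the
  transpose has derivative \<open>J\<^sup>T\<close>, the inverse has derivative \<open>- J\<close>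
  (\<open>has_real_derivative_det_at_identity\<close>, \<open>has_vector_derivative_matrix_inv_at_identity\<close>), and all these factors start at
  the identity or at 1. Hence the product rule merely adds up the derivatives of the factors: with
  \<open>L J = tr J I - J - J\<^sup>T\<close>, it gives \<open>- L J\<close> for the coefficient \<open>C\<close> and \<open>L J\<close> for \<open>A\<close>.

  What remains is analysis of the series, for infinite \<open>M\<close>. Absolute convergence in \<open>C\<^sup>1\<close> bounds the terms and their Jacobians
  uniformly by a summable sequence, so the velocity may be differentiated term by term
  (\<open>velocity_jacobian\<close>) and \<open>J = \<Sum> z\<^sub>i \<partial>V\<^sub>i\<close>. Since \<open>L\<close> is linear and continuous, it passes through
  this sum, and \<open>L (\<partial>V\<^sub>i)\<close> is the matrix field named \<open>dB\<close>.
\<close>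

section \<open>Matrix calculus along a line through the identity\<close>

lemma bounded_bilinear_matrix_matrix_mult:
  "bounded_bilinear ((**) :: real^'n^'m \<Rightarrow> real^'p^'n \<Rightarrow> real^'p^'m)"
  unfolding bilinear_conv_bounded_bilinear [symmetric] bilinear_def linear_iff
proof (intro conjI allI)
  show "(A + B) ** C = A ** C + B ** C" for A B :: "real^'n^'m" and C :: "real^'p^'n"
    by (simp add: matrix_matrix_mult_def vec_eq_iff distrib_right sum.distrib)
qed (simp_all add: matrix_add_ldistrib scalar_matrix_assoc matrix_scalar_ac)

lemma bounded_bilinear_matrix_vector_mult:
  "bounded_bilinear ((*v) :: real^'n^'m \<Rightarrow> real^'n \<Rightarrow> real^'m)"
  unfolding bilinear_conv_bounded_bilinear [symmetric] bilinear_def linear_iff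
  by (simp add: matrix_vector_right_distrib matrix_vector_mult_add_rdistrib
      scaleR_matrix_vector_assoc matrix_vector_mult_scaleR)

lemma bounded_linear_transpose: "bounded_linear (transpose :: real^'n^'m \<Rightarrow> real^'m^'n)"
  unfolding linear_conv_bounded_linear [symmetric] linear_iff
  by (simp add: transpose_def vec_eq_iff)

lemma permutes_eq_id_if_fixes_all_but_one:
  assumes "p permutes S" and "\<And>j. j \<in> S - {i} \<Longrightarrow> p j = j"
  shows "p = id"
proof -
  have "p permutes {i}"
    using assms by (intro permutes_superset [OF assms(1)]) auto
  then show ?thesis by simp
qed

text \<open>
  Differentiating the Leibniz expansion gives, for each permutation \<open>p\<close> and each \<open>i\<close>, the entry
  \<open>J $ i $ p i\<close> times off-\<open>i\<close> entries of the identity. A permutation other than the identity moves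
  at least two indices, hence one besides \<open>i\<close>, and the term vanishes; the identity permutation
  contributes the diagonal entries of \<open>J\<close>.
\<close>

lemma has_real_derivative_det_at_identity:
  fixes J :: "real^'n^'n"
  shows "((\<lambda>t. det (mat 1 + t *\<^sub>R J)) has_real_derivative trace J) (at 0)"
proof -
  let ?P = "{p :: 'n \<Rightarrow> 'n. p permutes UNIV}"
  let ?c = "\<lambda>p. \<Sum>i\<in>UNIV. J $ i $ p i * (\<Prod>j\<in>UNIV - {i}. (mat 1 :: real^'n^'n) $ j $ p j)"
  have entry: "((\<lambda>t. (mat 1 + t *\<^sub>R J) $ i $ k) has_real_derivative J $ i $ k) (at 0)" for i k
    by (auto intro!: derivative_eq_intros)
  have "((\<lambda>t. \<Prod>i\<in>UNIV. (mat 1 + t *\<^sub>R J) $ i $ p i) has_real_derivative ?c p) (at 0)" for p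
    using has_field_derivative_prod [of UNIV "\<lambda>i t. (mat 1 + t *\<^sub>R J) $ i $ p i",
        OF entry] by simp
  then have "((\<lambda>t. det (mat 1 + t *\<^sub>R J)) has_real_derivative
      (\<Sum>p\<in>?P. of_int (sign p) * ?c p)) (at 0)"
    unfolding det_def by (intro DERIV_sum DERIV_cmult)
  moreover have "(\<Sum>p\<in>?P. of_int (sign p) * ?c p) = of_int (sign (id :: 'n \<Rightarrow> 'n)) * ?c id"
  proof -
    have "?c p = 0" if "p \<in> ?P - {id}" for p
    proof (intro sum.neutral ballI)
      fix i
      obtain j where "j \<in> UNIV - {i}" "p j \<noteq> j"
        using \<open>p \<in> ?P - {id}\<close> permutes_eq_id_if_fixes_all_but_one [of p UNIV i] by blast
      then have "(\<Prod>j\<in>UNIV - {i}. (mat 1 :: real^'n^'n) $ j $ p j) = 0"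
        by (intro prod_zero bexI [of _ j]) (auto simp: mat_def)
      then show "J $ i $ p i * (\<Prod>j\<in>UNIV - {i}. (mat 1 :: real^'n^'n) $ j $ p j) = 0"
        by simp
    qed
    then have "(\<Sum>p\<in>?P. of_int (sign p) * ?c p) = (\<Sum>p\<in>{id}. of_int (sign p) * ?c p)"
      by (intro sum.mono_neutral_right) (auto simp: permutes_id)
    then show ?thesis by simp
  qed
  moreover have "?c id = trace J"
    by (simp add: trace_def mat_def)
  ultimately show ?thesis
    by (simp add: sign_id)
qed

text \<open>
  A form of the difference quotient criterion for vector-valued functions in which the quotient
  \<open>H\<close> is given by a formula, so that no division by \<open>t\<close> appears.
\<close>

lemma has_vector_derivative_at_zero_if_quotient_tendsto:
  fixes F H :: "real \<Rightarrow> 'a::real_normed_vector"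
  assumes "\<forall>\<^sub>F t in at 0. F t = F 0 + t *\<^sub>R H t" and "(H \<longlongrightarrow> D) (at 0)"
  shows "(F has_vector_derivative D) (at 0)"
proof -
  have "((\<lambda>t. norm (H t - D)) \<longlongrightarrow> 0) (at 0)"
    using assms(2) by (simp add: LIM_zero tendsto_norm_zero)
  moreover have "\<forall>\<^sub>F t in at 0. norm (H t - D) = norm (F (0 + t) - F 0 - t *\<^sub>R D) / norm t"
    using assms(1) eventually_neq_at_within [of 0]
    by eventually_elim (simp add: scaleR_diff_right [symmetric])
  ultimately have "((\<lambda>t. norm (F (0 + t) - F 0 - t *\<^sub>R D) / norm t) \<longlongrightarrow> 0) (at 0)"
    by (rule Lim_transform_eventually)
  then show ?thesis
    unfolding has_vector_derivative_def has_derivative_at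
    by (simp add: bounded_linear_scaleR_left)
qed

lemma matrix_inv_mult_self:
  assumes "invertible A"
  shows "A ** matrix_inv A = mat 1"
  unfolding matrix_inv_def
  by (rule conjunct1 [OF someI_ex [OF assms [unfolded invertible_def]]])

text \<open>
  The inverse \<open>X t\<close> of \<open>I + t J\<close> satisfies \<open>X t = I - t J (X t)\<close>, which exhibits \<open>- J (X t)\<close> as its
  difference quotient. So it suffices that \<open>X\<close> is continuous at 0, and the same equation yields
  this: for small \<open>t\<close> it bounds \<open>X t\<close>, and then it shows that \<open>X t - I\<close> is of order \<open>t\<close>. The
  equation is available only where \<open>I + t J\<close> is invertible, that is, near 0, where the determinant
  is close to 1.
\<close>

lemma has_vector_derivative_matrix_inv_at_identity:
  fixes J :: "real^'n^'n"
  shows "((\<lambda>t. matrix_inv (mat 1 + t *\<^sub>R J)) has_vector_derivative - J) (at 0)"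
proof -
  define X where "X = (\<lambda>t. matrix_inv (mat 1 + t *\<^sub>R J))"
  interpret mult: bounded_bilinear "(**) :: real^'n^'n \<Rightarrow> real^'n^'n \<Rightarrow> real^'n^'n"
    by (rule bounded_bilinear_matrix_matrix_mult)
  obtain K where "K > 0" and K: "\<And>(A :: real^'n^'n) (B :: real^'n^'n). norm (A ** B) \<le> norm A * norm B * K"
    using mult.pos_bounded by blast
  have "((\<lambda>t. det (mat 1 + t *\<^sub>R J)) \<longlongrightarrow> 1) (at 0)"
    using DERIV_isCont [OF has_real_derivative_det_at_identity [of J]]
    by (simp add: isCont_def)
  then have "\<forall>\<^sub>F t in at 0. 0 < det (mat 1 + t *\<^sub>R J)"
    by (rule order_tendstoD) simp_all
  then have X: "\<forall>\<^sub>F t in at 0. X t = mat 1 - t *\<^sub>R (J ** X t)"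
  proof eventually_elim
    case (elim t)
    then have "invertible (mat 1 + t *\<^sub>R J)"
      by (simp add: invertible_det_nz)
    from matrix_inv_mult_self [OF this] have "X t + t *\<^sub>R (J ** X t) = mat 1"
      by (simp add: X_def mult.add_left mult.scaleR_left)
    then show ?case
      by (simp only: eq_diff_eq)
  qed
  have "((\<lambda>t. \<bar>t\<bar> * (norm J * K)) \<longlongrightarrow> 0) (at 0)"
    by (auto intro!: tendsto_eq_intros)
  (* The bound 1/2 lets the term in norm (X t) be absorbed into the left-hand side below. *)
  then have small: "\<forall>\<^sub>F t in at 0. \<bar>t\<bar> * (norm J * K) < 1 / 2"
    by (rule order_tendstoD) simp_all
  have "\<forall>\<^sub>F t in at 0. norm (X t - mat 1) \<le> \<bar>t\<bar> * (norm J * K * (2 * norm (mat 1 :: real^'n^'n)))"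
    using X small
  proof eventually_elim
    case (elim t)
    have step: "norm (t *\<^sub>R (J ** X t)) \<le> \<bar>t\<bar> * (norm J * K) * norm (X t)"
      using mult_left_mono [OF K [of J "X t"], of "\<bar>t\<bar>"] by (simp add: mult_ac)
    also have "\<dots> \<le> 1 / 2 * norm (X t)"
      using elim(2) by (intro mult_right_mono) auto
    finally have "norm (mat 1 - t *\<^sub>R (J ** X t)) \<le> norm (mat 1 :: real^'n^'n) + 1 / 2 * norm (X t)"
      using norm_triangle_ineq4 [of "mat 1" "t *\<^sub>R (J ** X t)"] by simp
    then have "norm (X t) \<le> norm (mat 1 :: real^'n^'n) + 1 / 2 * norm (X t)"
      by (simp only: elim(1) [symmetric])
    then have "\<bar>t\<bar> * (norm J * K) * norm (X t)
        \<le> \<bar>t\<bar> * (norm J * K) * (2 * norm (mat 1 :: real^'n^'n))"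
      using \<open>K > 0\<close> by (intro mult_left_mono) auto
    moreover have "X t - mat 1 = - (t *\<^sub>R (J ** X t))"
      by (subst elim(1)) simp
    then have "norm (X t - mat 1) = norm (t *\<^sub>R (J ** X t))"
      by (simp only: norm_minus_cancel)
    ultimately show ?case
      using step by (simp add: mult_ac)
  qed
  moreover have "((\<lambda>t. \<bar>t\<bar> * (norm J * K * (2 * norm (mat 1 :: real^'n^'n)))) \<longlongrightarrow> 0) (at 0)"
    by (auto intro!: tendsto_eq_intros)
  ultimately have "((\<lambda>t. X t - mat 1) \<longlongrightarrow> 0) (at 0)"
    by (rule Lim_null_comparison)
  then have "(X \<longlongrightarrow> mat 1) (at 0)"
    by (rule LIM_zero_cancel)
  then have "((\<lambda>t. - (J ** X t)) \<longlongrightarrow> - J) (at 0)"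
    using tendsto_minus [OF mult.tendsto [OF tendsto_const [of J]]] by fastforce
  moreover have "X 0 = mat 1"
    using matrix_inv_mult_self [of "mat 1 :: real^'n^'n"]
    by (simp add: X_def invertible_det_nz)
  with X have "\<forall>\<^sub>F t in at 0. X t = X 0 + t *\<^sub>R (- (J ** X t))"
    by simp
  ultimately have "(X has_vector_derivative - J) (at 0)"
    by (intro has_vector_derivative_at_zero_if_quotient_tendsto [where H = "\<lambda>t. - (J ** X t)"])
  then show ?thesis
    by (simp add: X_def)
qed

lemma matrix_inv_identity: "matrix_inv (mat 1 :: real^'n^'n) = mat 1"
  using matrix_inv_mult_self [of "mat 1 :: real^'n^'n"] by (simp add: invertible_det_nz)

lemma has_vector_derivative_gram_div_det_at_identity:
  fixes J :: "real^'n^'n"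
  shows "((\<lambda>t. (1 / det (mat 1 + t *\<^sub>R J)) *\<^sub>R
            (transpose (mat 1 + t *\<^sub>R J) ** (mat 1 + t *\<^sub>R J)))
          has_vector_derivative - (trace J *\<^sub>R mat 1 - J - transpose J)) (at 0)"
proof -
  have line: "((\<lambda>t. mat 1 + t *\<^sub>R J) has_vector_derivative J) (at 0)"
    by (auto intro!: derivative_eq_intros)
  have gram: "((\<lambda>t. transpose (mat 1 + t *\<^sub>R J) ** (mat 1 + t *\<^sub>R J))
      has_vector_derivative J + transpose J) (at 0)"
    using bounded_bilinear.has_vector_derivative [OF bounded_bilinear_matrix_matrix_mult
        bounded_linear.has_vector_derivative [OF bounded_linear_transpose line] line]
    by simp
  have "((\<lambda>t. 1 / det (mat 1 + t *\<^sub>R J)) has_real_derivative - trace J) (at 0)"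
    by (auto intro!: derivative_eq_intros has_real_derivative_det_at_identity)
  from has_vector_derivative_scaleR [OF this gram] show ?thesis
    by (simp add: algebra_simps)
qed

lemma has_vector_derivative_det_inverse_gram_at_identity:
  fixes J :: "real^'n^'n"
  shows "((\<lambda>t. det (mat 1 + t *\<^sub>R J) *\<^sub>R
            (matrix_inv (mat 1 + t *\<^sub>R J) ** transpose (matrix_inv (mat 1 + t *\<^sub>R J))))
          has_vector_derivative trace J *\<^sub>R mat 1 - J - transpose J) (at 0)"
proof -
  note inv = has_vector_derivative_matrix_inv_at_identity [of J]
  have "transpose (- J) = - transpose J"
    by (simp add: transpose_def vec_eq_iff)
  then have gram: "((\<lambda>t. matrix_inv (mat 1 + t *\<^sub>R J) ** transpose (matrix_inv (mat 1 + t *\<^sub>R J)))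
      has_vector_derivative - J - transpose J) (at 0)"
    using bounded_bilinear.has_vector_derivative [OF bounded_bilinear_matrix_matrix_mult
        inv bounded_linear.has_vector_derivative [OF bounded_linear_transpose inv]]
    by (simp add: matrix_inv_identity minus_diff_commute)
  from has_vector_derivative_scaleR [OF has_real_derivative_det_at_identity gram] show ?thesis
    by (simp add: matrix_inv_identity algebra_simps)
qed

section \<open>Term-by-term differentiation of the velocity\<close>

lemma jacobian_eqI:
  fixes f :: "real^'n \<Rightarrow> real^'m"
  assumes "(f has_derivative (*v) A) (at x)"
  shows "jacobian f (at x) = A"
  using frechet_derivative_at [OF assms, symmetric]
  by (simp add: jacobian_def matrix_of_matrix_vector_mul)

lemma jacobian_scaleR:
  fixes f :: "real^'n \<Rightarrow> real^'m"
  assumes "f differentiable at x"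
  shows "jacobian (\<lambda>y. c *\<^sub>R f y) (at x) = c *\<^sub>R jacobian f (at x)"
proof (rule jacobian_eqI)
  have "((\<lambda>y. c *\<^sub>R f y) has_derivative (\<lambda>h. c *\<^sub>R (jacobian f (at x) *v h))) (at x)"
    using assms by (intro has_derivative_scaleR_right) (simp add: jacobian_works)
  then show "((\<lambda>y. c *\<^sub>R f y) has_derivative (*v) (c *\<^sub>R jacobian f (at x))) (at x)"
    by (simp add: scaleR_matrix_vector_assoc)
qed

lemma has_sum_imp_sums_extended_by_zero:
  fixes f :: "nat \<Rightarrow> 'a::{topological_comm_monoid_add,t2_space}"
  assumes "(f has_sum s) I"
  shows "(\<lambda>i. if i \<in> I then f i else 0) sums s"
proof -
  have "((\<lambda>i. if i \<in> I then f i else 0) has_sum s) UNIV"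
    using assms by (subst has_sum_cong_neutral [where T = I and g = f]) auto
  then show ?thesis
    by (rule has_sum_imp_sums)
qed

text \<open>
  Term-by-term differentiation under a summable majorant of the terms and of their Jacobians. By
  the Weierstrass test the series of Jacobians converges uniformly, which is what differentiating
  a series on a convex set requires; a ball around \<open>x\<close> serves as that set. The index set is
  reached by extending the terms by zero to all natural numbers; because the sums are
  unconditional, this does not change their values.
\<close>

lemma has_derivative_infsum_matrix:
  fixes f :: "nat \<Rightarrow> real^'n \<Rightarrow> real^'m" and J :: "nat \<Rightarrow> real^'n \<Rightarrow> real^'n^'m"
  assumes S: "open S" and x: "x \<in> S"
    and deriv: "\<And>i y. i \<in> I \<Longrightarrow> y \<in> S \<Longrightarrow> (f i has_derivative (*v) (J i y)) (at y)"
    and f_bound: "\<And>i y. i \<in> I \<Longrightarrow> y \<in> S \<Longrightarrow> norm (f i y) \<le> B i"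
    and J_bound: "\<And>i y. i \<in> I \<Longrightarrow> y \<in> S \<Longrightarrow> norm (J i y) \<le> B i"
    and B: "B summable_on I"
  shows "(\<lambda>i. J i x) summable_on I"
    and "((\<lambda>y. \<Sum>\<^sub>\<infinity>i\<in>I. f i y) has_derivative (*v) (\<Sum>\<^sub>\<infinity>i\<in>I. J i x)) (at x)"
proof -
  have J_summable: "(\<lambda>i. J i y) summable_on I" if "y \<in> S" for y
    by (rule abs_summable_summable, rule Infinite_Sum.abs_summable_on_comparison_test' [OF B J_bound])
      (use that in auto)
  have f_summable: "(\<lambda>i. f i y) summable_on I" if "y \<in> S" for y
    by (rule abs_summable_summable, rule Infinite_Sum.abs_summable_on_comparison_test' [OF B f_bound])
      (use that in auto)
  show "(\<lambda>i. J i x) summable_on I"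
    using J_summable x .
  let ?f = "\<lambda>i y. if i \<in> I then f i y else 0"
  let ?J = "\<lambda>i y. if i \<in> I then J i y else 0"
  let ?DJ = "\<lambda>y. \<Sum>\<^sub>\<infinity>i\<in>I. J i y"
  have f_sums: "(\<lambda>i. ?f i y) sums (\<Sum>\<^sub>\<infinity>i\<in>I. f i y)" if "y \<in> S" for y
    by (rule has_sum_imp_sums_extended_by_zero [OF has_sum_infsum [OF f_summable [OF that]]])
  have J_sums: "(\<lambda>i. ?J i y) sums ?DJ y" if "y \<in> S" for y
    by (rule has_sum_imp_sums_extended_by_zero [OF has_sum_infsum [OF J_summable [OF that]]])
  have "uniform_limit S (\<lambda>n y. \<Sum>i<n. ?J i y) (\<lambda>y. \<Sum>i. ?J i y) sequentially"
  proof (rule Weierstrass_m_test)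
    show "norm (?J i y) \<le> (if i \<in> I then B i else 0)" if "y \<in> S" for i y
      using that J_bound by simp
    show "summable (\<lambda>i. if i \<in> I then B i else 0)"
      using has_sum_imp_sums_extended_by_zero [OF has_sum_infsum [OF B]] by (rule sums_summable)
  qed
  moreover have "(\<Sum>i. ?J i y) = ?DJ y" if "y \<in> S" for y
    using J_sums [OF that] by (rule sums_unique [symmetric])
  ultimately have unif: "uniform_limit S (\<lambda>n y. \<Sum>i<n. ?J i y) ?DJ sequentially"
    by (simp only: cong: uniform_limit_cong')
  obtain r where "r > 0" and r: "ball x r \<subseteq> S"
    using S x by (meson open_contains_ball)
  interpret mv: bounded_bilinear "(*v) :: real^'n^'m \<Rightarrow> real^'n \<Rightarrow> real^'m"
    by (rule bounded_bilinear_matrix_vector_mult)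
  obtain K where "K > 0" and K: "\<And>(A :: real^'n^'m) h. norm (A *v h) \<le> norm A * norm h * K"
    using mv.pos_bounded by blast
  have "\<exists>g. \<forall>y\<in>ball x r. (\<lambda>i. ?f i y) sums g y \<and>
      (g has_derivative (*v) (?DJ y)) (at y within ball x r)"
  proof (rule has_derivative_series)
    show "(?f i has_derivative (*v) (?J i y)) (at y within ball x r)" if "y \<in> ball x r" for i y
    proof (cases "i \<in> I")
      case True
      with r that have "(f i has_derivative (*v) (J i y)) (at y)"
        by (intro deriv) auto
      with True show ?thesis
        by (simp add: has_derivative_at_withinI)
    next
      case False
      have "(*v) (0 :: real^'n^'m) = (\<lambda>h. 0)"
        by (simp add: fun_eq_iff)
      with False show ?thesis
        by simp
    qed
    show "\<forall>\<^sub>F n in sequentially. \<forall>y\<in>ball x r. \<forall>h.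
        norm ((\<Sum>i<n. ?J i y *v h) - ?DJ y *v h) \<le> e * norm h" if "e > 0" for e
    proof -
      have "\<forall>\<^sub>F n in sequentially. \<forall>y\<in>S. dist (\<Sum>i<n. ?J i y) (?DJ y) < e / K"
        using unif \<open>e > 0\<close> \<open>K > 0\<close> by (auto simp: uniform_limit_iff)
      then show ?thesis
      proof (eventually_elim, intro ballI allI)
        fix n and y h :: "real^'n"
        assume *: "\<forall>y\<in>S. dist (\<Sum>i<n. ?J i y) (?DJ y) < e / K" and "y \<in> ball x r"
        then have "norm ((\<Sum>i<n. ?J i y) - ?DJ y) \<le> e / K"
          using r by (fastforce simp: dist_norm intro: less_imp_le)
        then have "norm ((\<Sum>i<n. ?J i y) - ?DJ y) * norm h * K \<le> e / K * norm h * K"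
          using \<open>K > 0\<close> by (intro mult_right_mono) auto
        with K [of "(\<Sum>i<n. ?J i y) - ?DJ y" h]
        have "norm (((\<Sum>i<n. ?J i y) - ?DJ y) *v h) \<le> e * norm h"
          using \<open>K > 0\<close> by simp
        then show "norm ((\<Sum>i<n. ?J i y *v h) - ?DJ y *v h) \<le> e * norm h"
          by (simp only: mv.diff_left mv.sum_left)
      qed
    qed
    show "(\<lambda>i. ?f i x) sums (\<Sum>\<^sub>\<infinity>i\<in>I. f i x)"
      using f_sums x .
  qed (use \<open>r > 0\<close> in auto)
  then obtain g where g: "\<And>y. y \<in> ball x r \<Longrightarrow> (\<lambda>i. ?f i y) sums g y"
    and dg: "(g has_derivative (*v) (?DJ x)) (at x within ball x r)"
    using \<open>r > 0\<close> by (meson centre_in_ball)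
  have eq: "g y = (\<Sum>\<^sub>\<infinity>i\<in>I. f i y)" if "y \<in> ball x r" for y
    using g [OF that] f_sums [of y] r that by (blast intro: sums_unique2)
  have "(g has_derivative (*v) (?DJ x)) (at x)"
    using dg \<open>r > 0\<close> at_within_open [of x "ball x r"] by simp
  then show "((\<lambda>y. \<Sum>\<^sub>\<infinity>i\<in>I. f i y) has_derivative (*v) (?DJ x)) (at x)"
    by (rule has_derivative_transform_within_open [of _ _ _ _ "ball x r"])
       (use eq \<open>r > 0\<close> in auto)
qed

text \<open>
  The boundedness assumptions make the suprema genuine upper bounds; the supremum of an unbounded
  set of reals is an unspecified number.
\<close>

lemma norm_le_C1_norm:
  assumes "bounded (f ` D)" and "bounded ((\<lambda>x. jacobian f (at x)) ` D)" and x: "x \<in> D"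
  shows "norm (f x) \<le> C1_norm D f" and "norm (jacobian f (at x)) \<le> C1_norm D f"
proof -
  have "bdd_above ((\<lambda>x. norm (f x)) ` D)" "bdd_above ((\<lambda>x. norm (jacobian f (at x))) ` D)"
    using assms by (auto simp: bounded_iff bdd_above_def)
  then have "norm (f x) \<le> (SUP x\<in>D. norm (f x))"
    "norm (jacobian f (at x)) \<le> (SUP x\<in>D. norm (jacobian f (at x)))"
    using x by (auto intro: cSUP_upper)
  then show "norm (f x) \<le> C1_norm D f" "norm (jacobian f (at x)) \<le> C1_norm D f"
    unfolding C1_norm_def using norm_ge_zero [of "f x"] norm_ge_zero [of "jacobian f (at x)"]
    by linarith+
qed

lemma finite_index_set_iff: "finite (index_set M) \<longleftrightarrow> M \<noteq> \<infinity>"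
proof (cases M)
  case (enat n)
  then have "index_set M = {1..n}"
    by (auto simp: index_set_def)
  with enat show ?thesis by simp
next
  case infinity
  then have "index_set M = {1..}"
    by (auto simp: index_set_def)
  with infinity show ?thesis by (simp add: infinite_Ici)
qed

text \<open>
  For finite \<open>M\<close> this is linearity of the derivative.
  For infinite \<open>M\<close> the \<open>C\<^sup>1\<close> norms of the terms are the majorant for term-by-term differentiation.
\<close>

lemma velocity_jacobian:
  assumes "open D" and x: "x \<in> D"
    and smooth: "\<And>i. i \<in> index_set M \<Longrightarrow> C1_field_on D (V i)"
    and convergent: "M = \<infinity> \<Longrightarrow> C1_absolutely_convergent D (\<lambda>i x. z i *\<^sub>R V i x) (index_set M)"
  shows "(\<lambda>i. z i *\<^sub>R jacobian (V i) (at x)) summable_on index_set M"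
    and "(velocity M V z has_derivative
      (*v) (\<Sum>\<^sub>\<infinity>i\<in>index_set M. z i *\<^sub>R jacobian (V i) (at x))) (at x)"
proof -
  have deriv: "((\<lambda>y. z i *\<^sub>R V i y) has_derivative (*v) (z i *\<^sub>R jacobian (V i) (at y))) (at y)"
    and jac: "jacobian (\<lambda>y. z i *\<^sub>R V i y) (at y) = z i *\<^sub>R jacobian (V i) (at y)"
    if "i \<in> index_set M" "y \<in> D" for i y
  proof -
    have *: "V i differentiable at y"
      using smooth [OF that(1)] that(2) by (simp add: C1_field_on_def)
    then show "jacobian (\<lambda>y. z i *\<^sub>R V i y) (at y) = z i *\<^sub>R jacobian (V i) (at y)"
      by (rule jacobian_scaleR)
    from * have "(\<lambda>y. z i *\<^sub>R V i y) differentiable at y"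
      by (intro differentiable_scaleR) auto
    then show "((\<lambda>y. z i *\<^sub>R V i y) has_derivative (*v) (z i *\<^sub>R jacobian (V i) (at y))) (at y)"
      by (simp add: jacobian_works jacobian_scaleR [OF *])
  qed
  have "(\<lambda>i. z i *\<^sub>R jacobian (V i) (at x)) summable_on index_set M \<and>
    (velocity M V z has_derivative
      (*v) (\<Sum>\<^sub>\<infinity>i\<in>index_set M. z i *\<^sub>R jacobian (V i) (at x))) (at x)"
  proof (cases "M = \<infinity>")
    case False
    then have fin: "finite (index_set M)"
      by (simp add: finite_index_set_iff)
    have "((\<lambda>y. \<Sum>i\<in>index_set M. z i *\<^sub>R V i y) has_derivative
        (\<lambda>h. \<Sum>i\<in>index_set M. (z i *\<^sub>R jacobian (V i) (at x)) *v h)) (at x)"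
      using deriv x by (intro has_derivative_sum) auto
    with fin show ?thesis
      unfolding velocity_def [abs_def]
      by (simp add: bounded_bilinear.sum_left [OF bounded_bilinear_matrix_vector_mult, symmetric])
  next
    case True
    let ?B = "\<lambda>i. C1_norm D (\<lambda>y. z i *\<^sub>R V i y)"
    note conv = convergent [OF True, unfolded C1_absolutely_convergent_def]
    have "norm (z i *\<^sub>R V i y) \<le> ?B i" "norm (z i *\<^sub>R jacobian (V i) (at y)) \<le> ?B i"
      if "i \<in> index_set M" "y \<in> D" for i y
      using norm_le_C1_norm [of "\<lambda>y. z i *\<^sub>R V i y" D y] conv that jac [OF that] by auto
    then show ?thesis
      unfolding velocity_def [abs_def]
      using has_derivative_infsum_matrix [OF \<open>open D\<close> x deriv, where B = ?B] conv
      by auto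
  qed
  then show "(\<lambda>i. z i *\<^sub>R jacobian (V i) (at x)) summable_on index_set M"
    and "(velocity M V z has_derivative
      (*v) (\<Sum>\<^sub>\<infinity>i\<in>index_set M. z i *\<^sub>R jacobian (V i) (at x))) (at x)"
    by auto
qed

section \<open>Derivatives of the deformation coefficients\<close>

text \<open>
  Continuity of this map is what allows it to be applied to the velocity's Jacobian under an
  infinite sum.
\<close>

lemma bounded_linear_trace_minus_symmetrisation:
  "bounded_linear (\<lambda>J :: real^'n^'n. trace J *\<^sub>R mat 1 - J - transpose J)"
  unfolding linear_conv_bounded_linear [symmetric] linear_iff
  by (simp add: trace_def transpose_def vec_eq_iff sum.distrib sum_distrib_left algebra_simps)

theorem lemma6:
  fixes D0 :: "(real^3) set"
    and M :: enat
    and P :: "'w measure"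
    and Z :: "nat \<Rightarrow> 'w \<Rightarrow> real"
    and V :: "nat \<Rightarrow> real^3 \<Rightarrow> real^3"
  assumes domain: "bounded_lipschitz_domain D0"
    and random: "iid_uniform P (index_set M) Z"
    and smooth: "\<And>i. i \<in> index_set M \<Longrightarrow> C1_field_on D0 (V i)"
    and convergent: "\<And>\<omega>. M = \<infinity> \<Longrightarrow> \<omega> \<in> space P \<Longrightarrow>
      C1_absolutely_convergent D0 (\<lambda>i x. Z i \<omega> *\<^sub>R V i x) (index_set M)"
  shows "\<forall>\<omega>\<in>space P. \<forall>x\<in>D0.
    (let z = (\<lambda>i. Z i \<omega>);
         G = deformation M V z
     in (\<lambda>i. z i *\<^sub>R dB (V i) x) summable_on index_set M \<and>
        ((\<lambda>t. C_coeff (G t) x) has_vector_derivative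
           - (\<Sum>\<^sub>\<infinity>i\<in>index_set M. z i *\<^sub>R dB (V i) x)) (at 0) \<and>
        ((\<lambda>t. A_coeff (G t) x) has_vector_derivative
           (\<Sum>\<^sub>\<infinity>i\<in>index_set M. z i *\<^sub>R dB (V i) x)) (at 0))"
proof (intro ballI)
  fix \<omega> x
  assume \<omega>: "\<omega> \<in> space P" and x: "x \<in> D0"
  define z where "z = (\<lambda>i. Z i \<omega>)"
  define J where "J = (\<Sum>\<^sub>\<infinity>i\<in>index_set M. z i *\<^sub>R jacobian (V i) (at x))"
  let ?G = "deformation M V z"
  let ?L = "\<lambda>J :: real^3^3. trace J *\<^sub>R mat 1 - J - transpose J"
  have "open D0"
    using domain by (simp add: bounded_lipschitz_domain_def)
  have conv: "M = \<infinity> \<Longrightarrow> C1_absolutely_convergent D0 (\<lambda>i x. z i *\<^sub>R V i x) (index_set M)"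
    using convergent [OF _ \<omega>] by (simp add: z_def)
  note vel = velocity_jacobian [OF \<open>open D0\<close> x smooth conv, folded J_def]
  have "jacobian (?G t) (at x) = mat 1 + t *\<^sub>R J" for t
  proof (rule jacobian_eqI)
    have "(?G t has_derivative (\<lambda>h. h + t *\<^sub>R (J *v h))) (at x)"
      unfolding deformation_def [abs_def]
      by (intro has_derivative_add has_derivative_ident has_derivative_scaleR_right vel(2))
    then show "(?G t has_derivative (*v) (mat 1 + t *\<^sub>R J)) (at x)"
      by (rule has_derivative_eq_rhs)
         (simp add: fun_eq_iff matrix_vector_mult_add_rdistrib scaleR_matrix_vector_assoc)
  qed
  then have C: "((\<lambda>t. C_coeff (?G t) x) has_vector_derivative - ?L J) (at 0)"
    and A: "((\<lambda>t. A_coeff (?G t) x) has_vector_derivative ?L J) (at 0)"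
    unfolding C_coeff_def A_coeff_def Let_def
    using has_vector_derivative_gram_div_det_at_identity [of J]
      has_vector_derivative_det_inverse_gram_at_identity [of J]
    by simp_all
  have "((\<lambda>i. z i *\<^sub>R jacobian (V i) (at x)) has_sum J) (index_set M)"
    unfolding J_def by (rule has_sum_infsum [OF vel(1)])
  from has_sum_bounded_linear [OF bounded_linear_trace_minus_symmetrisation this]
  have sum: "((\<lambda>i. z i *\<^sub>R dB (V i) x) has_sum ?L J) (index_set M)"
    by (simp add: dB_def Let_def linear_scale [OF bounded_linear.linear
          [OF bounded_linear_trace_minus_symmetrisation]])
  with C A show "let z = (\<lambda>i. Z i \<omega>);
         G = deformation M V z
     in (\<lambda>i. z i *\<^sub>R dB (V i) x) summable_on index_set M \<and>
        ((\<lambda>t. C_coeff (G t) x) has_vector_derivative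
           - (\<Sum>\<^sub>\<infinity>i\<in>index_set M. z i *\<^sub>R dB (V i) x)) (at 0) \<and>
        ((\<lambda>t. A_coeff (G t) x) has_vector_derivative
           (\<Sum>\<^sub>\<infinity>i\<in>index_set M. z i *\<^sub>R dB (V i) x)) (at 0)"
    unfolding z_def [symmetric] Let_def by (auto simp: infsumI summable_on_def)
qed

end
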